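(* Let $\varphi$ be a formula, $w$ an infinite word over $2^{\mathrm{Var}(\varphi)}$, and $t\in\mathbb{N}$. Then $(w,t)\models\varphi$ if and only if $w_t\models\varphi\langle\circ\vec C_{\varphi,t}\rangle$.
   Context: Syntax. Formulae are pLTL formulae in negation normal form: built from $\top,\bot$, literals $p,\neg p$ ($p$ an atomic proposition), $\wedge,\vee$, future operators $\mathbf{X}$ (unary), $\mathbf{U},\mathbf{W},\mathbf{R},\mathbf{M}$ (binary), and past operators $\mathbf{Y},\tilde{\mathbf{Y}}$ (unary), $\mathbf{S},\tilde{\mathbf{S}},\mathbf{B},\tilde{\mathbf{B}}$ (binary). $\mathrm{Var}(\varphi)$ is the set of atomic propositions in $\varphi$. Semantics. For an infinite word $w=\sigma_0\sigma_1\dots$ of sets of propositions and $t\in\mathbb{N}$: $(w,t)\models p$ iff $p\in\sigma_t$; Boolean cases as usual; $(w,t)\models\mathbf{X}\psi$ iff $(w,t+1)\models\psi$; $(w,t)\models\mathbf{Y}\psi$ iff $t>0$ and $(w,t-1)\models\psi$; $(w,t)\models\tilde{\mathbf{Y}}\psi$ iff $t=0$ or $(w,t-1)\models\psi$; $(w,t)\models\psi\mathbf{U}\xi$ iff $\exists r\ge t$ with $(w,r)\models\xi$ and $(w,s)\models\psi$ for all $s\in[t,r)$; $(w,t)\models\psi\mathbf{S}\xi$ iff $\exists r\le t$ with $(w,r)\models\xi$ and $(w,s)\models\psi$ for all $s\in(r,t]$; $\psi\mathbf{W}\xi$ holds at $t$ iff $\psi\mathbf{U}\xi$ holds at $t$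 or $\psi$ holds at all $s\ge t$; $\psi\tilde{\mathbf{S}}\xi$ holds at $t$ iff $\psi\mathbf{S}\xi$ holds at $t$ or $\psi$ holds at all $s\le t$; semantically $\psi\mathbf{M}\xi:=\xi\mathbf{U}(\psi\wedge\xi)$, $\psi\mathbf{R}\xi:=\xi\mathbf{W}(\psi\wedge\xi)$, $\psi\mathbf{B}\xi:=\xi\mathbf{S}(\psi\wedge\xi)$, $\psi\tilde{\mathbf{B}}\xi:=\xi\tilde{\mathbf{S}}(\psi\wedge\xi)$. $w\models\varphi$ means $(w,0)\models\varphi$. $w_t$ is the suffix $\sigma_t\sigma_{t+1}\dots$. Rewriting. A past formula is one whose root is one of $\mathbf{Y},\tilde{\mathbf{Y}},\mathbf{S},\tilde{\mathbf{S}},\mathbf{B},\tilde{\mathbf{B}}$; $\mathit{psf}(\varphi)$ is the set of past subformulae of $\varphi$. The weakening $\varphi_{\mathcal W}$ replaces a root operator $\mathbf{Y},\mathbf{S},\mathbf{B}$ by $\tilde{\mathbf{Y}},\tilde{\mathbf{S}},\tilde{\mathbf{B}}$ respectively (otherwise $\varphi_{\mathcal W}=\varphi$); the strengthening $\varphi_{\mathcal S}$ replaces a root $\tilde{\mathbf{Y}},\tilde{\mathbf{S}},\tilde{\mathbf{B}}$ by $\mathbf{Y},\mathbf{S},\mathbf{B}$ (otherwise $\varphi_{\mathcal S}=\varphi$). For a set $C$ of past formulae, $\varphi\langle C\rangle$ is defined recursively: atoms are unchanged; $(\mathit{op}\,\psi)\langle C\rangle$ is $(\mathit{op}\,\psi\langle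 C\rangle)_{\mathcal W}$ if $\mathit{op}\,\psi\in C$ and $(\mathit{op}\,\psi\langle C\rangle)_{\mathcal S}$ otherwise; $(\psi\,\mathit{op}\,\xi)\langle C\rangle$ is $(\psi\langle C\rangle\,\mathit{op}\,\xi\langle C\rangle)_{\mathcal W}$ if $\psi\,\mathit{op}\,\xi\in C$ and $(\psi\langle C\rangle\,\mathit{op}\,\xi\langle C\rangle)_{\mathcal S}$ otherwise. Weakening conditions: $\mathit{wc}(\mathbf{Y}\psi)=\mathit{wc}(\tilde{\mathbf{Y}}\psi)=\psi$, $\mathit{wc}(\psi\mathbf{S}\xi)=\xi$, $\mathit{wc}(\psi\tilde{\mathbf{S}}\xi)=\psi\vee\xi$, $\mathit{wc}(\psi\mathbf{B}\xi)=\psi\wedge\xi$, $\mathit{wc}(\psi\tilde{\mathbf{B}}\xi)=\xi$. Entailed sets (for the given $w$). $C_{\varphi,0}=\{\psi\in\mathit{psf}(\varphi)\mid\psi=\psi_{\mathcal W}\}$ and, for $t>0$, $C_{\varphi,t}=\{\psi\in\mathit{psf}(\varphi\langle C_{\varphi,0}\rangle\langle C_{\varphi,1}\rangle\cdots\langle C_{\varphi,t-1}\rangle)\mid w_{t-1}\models\mathit{wc}(\psi)\}$. $\vec C_{\varphi,t}$ is the sequence $C_{\varphi,0},\dots,C_{\varphi,t}$, and $\circ\vec C_{\varphi,t}=\{\psi\in\mathit{psf}(\varphi)\mid \psi\langle C_{\varphi,0}\rangle\cdots\langle C_{\varphi,t}\rangle=(\psi\langle C_{\varphi,0}\rangle\cdots\langle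 C_{\varphi,t}\rangle)_{\mathcal W}\}$ (so that $\varphi\langle\circ\vec C_{\varphi,t}\rangle=\varphi\langle C_{\varphi,0}\rangle\cdots\langle C_{\varphi,t}\rangle$). *)

theory Defs
  imports Main "HOL-Library.Omega_Words_Fun"
begin

section \<open>Syntax of pLTL in negation normal form\<close>

text \<open>The primed constructors are the weak variants of the past operators.\<close>

datatype (vars: 'a) pltl =
    Tru
  | Fls
  | Prop 'a
  | NProp 'a
  | And "'a pltl" "'a pltl"
  | Or "'a pltl" "'a pltl"
  | X "'a pltl"
  | U "'a pltl" "'a pltl"
  | W "'a pltl" "'a pltl"
  | R "'a pltl" "'a pltl"
  | M "'a pltl" "'a pltl"
  | Y "'a pltl"
  | Y' "'a pltl"
  | S "'a pltl" "'a pltl"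
  | S' "'a pltl" "'a pltl"
  | B "'a pltl" "'a pltl"
  | B' "'a pltl" "'a pltl"


section \<open>Semantics\<close>

definition until_at :: "(nat \<Rightarrow> bool) \<Rightarrow> (nat \<Rightarrow> bool) \<Rightarrow> nat \<Rightarrow> bool" where
  "until_at P Q t \<longleftrightarrow> (\<exists>r\<ge>t. Q r \<and> (\<forall>s. t \<le> s \<and> s < r \<longrightarrow> P s))"

definition weak_until_at :: "(nat \<Rightarrow> bool) \<Rightarrow> (nat \<Rightarrow> bool) \<Rightarrow> nat \<Rightarrow> bool" where
  "weak_until_at P Q t \<longleftrightarrow> until_at P Q t \<or> (\<forall>s\<ge>t. P s)"

definition since_at :: "(nat \<Rightarrow> bool) \<Rightarrow> (nat \<Rightarrow> bool) \<Rightarrow> nat \<Rightarrow> bool" where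
  "since_at P Q t \<longleftrightarrow> (\<exists>r\<le>t. Q r \<and> (\<forall>s. r < s \<and> s \<le> t \<longrightarrow> P s))"

definition weak_since_at :: "(nat \<Rightarrow> bool) \<Rightarrow> (nat \<Rightarrow> bool) \<Rightarrow> nat \<Rightarrow> bool" where
  "weak_since_at P Q t \<longleftrightarrow> since_at P Q t \<or> (\<forall>s\<le>t. P s)"

primrec sat :: "'a set word \<Rightarrow> 'a pltl \<Rightarrow> nat \<Rightarrow> bool" where
  "sat w Tru t = True"
| "sat w Fls t = False"
| "sat w (Prop p) t = (p \<in> w t)"
| "sat w (NProp p) t = (p \<notin> w t)"
| "sat w (And \<psi> \<xi>) t = (sat w \<psi> t \<and> sat w \<xi> t)"
| "sat w (Or \<psi> \<xi>) t = (sat w \<psi> t \<or> sat w \<xi> t)"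
| "sat w (X \<psi>) t = sat w \<psi> (t + 1)"
| "sat w (U \<psi> \<xi>) t = until_at (sat w \<psi>) (sat w \<xi>) t"
| "sat w (W \<psi> \<xi>) t = weak_until_at (sat w \<psi>) (sat w \<xi>) t"
| "sat w (R \<psi> \<xi>) t = weak_until_at (sat w \<xi>) (\<lambda>s. sat w \<psi> s \<and> sat w \<xi> s) t"
| "sat w (M \<psi> \<xi>) t = until_at (sat w \<xi>) (\<lambda>s. sat w \<psi> s \<and> sat w \<xi> s) t"
| "sat w (Y \<psi>) t = (t > 0 \<and> sat w \<psi> (t - 1))"
| "sat w (Y' \<psi>) t = (t = 0 \<or> sat w \<psi> (t - 1))"
| "sat w (S \<psi> \<xi>) t = since_at (sat w \<psi>) (sat w \<xi>) t"
| "sat w (S' \<psi> \<xi>) t = weak_since_at (sat w \<psi>) (sat w \<xi>) t"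
| "sat w (B \<psi> \<xi>) t = since_at (sat w \<xi>) (\<lambda>s. sat w \<psi> s \<and> sat w \<xi> s) t"
| "sat w (B' \<psi> \<xi>) t = weak_since_at (sat w \<xi>) (\<lambda>s. sat w \<psi> s \<and> sat w \<xi> s) t"

abbreviation models :: "'a set word \<Rightarrow> 'a pltl \<Rightarrow> bool" (infix "\<Turnstile>" 50) where
  "w \<Turnstile> \<phi> \<equiv> sat w \<phi> 0"


section \<open>Past subformulae, weakening and strengthening\<close>

fun is_past :: "'a pltl \<Rightarrow> bool" where
  "is_past (Y \<psi>) = True"
| "is_past (Y' \<psi>) = True"
| "is_past (S \<psi> \<xi>) = True"
| "is_past (S' \<psi> \<xi>) = True"
| "is_past (B \<psi> \<xi>) = True"
| "is_past (B' \<psi> \<xi>) = True"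
| "is_past _ = False"

primrec subformulae :: "'a pltl \<Rightarrow> 'a pltl set" where
  "subformulae Tru = {Tru}"
| "subformulae Fls = {Fls}"
| "subformulae (Prop p) = {Prop p}"
| "subformulae (NProp p) = {NProp p}"
| "subformulae (And \<psi> \<xi>) = {And \<psi> \<xi>} \<union> subformulae \<psi> \<union> subformulae \<xi>"
| "subformulae (Or \<psi> \<xi>) = {Or \<psi> \<xi>} \<union> subformulae \<psi> \<union> subformulae \<xi>"
| "subformulae (X \<psi>) = {X \<psi>} \<union> subformulae \<psi>"
| "subformulae (U \<psi> \<xi>) = {U \<psi> \<xi>} \<union> subformulae \<psi> \<union> subformulae \<xi>"
| "subformulae (W \<psi> \<xi>) = {W \<psi> \<xi>} \<union> subformulae \<psi> \<union> subformulae \<xi>"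
| "subformulae (R \<psi> \<xi>) = {R \<psi> \<xi>} \<union> subformulae \<psi> \<union> subformulae \<xi>"
| "subformulae (M \<psi> \<xi>) = {M \<psi> \<xi>} \<union> subformulae \<psi> \<union> subformulae \<xi>"
| "subformulae (Y \<psi>) = {Y \<psi>} \<union> subformulae \<psi>"
| "subformulae (Y' \<psi>) = {Y' \<psi>} \<union> subformulae \<psi>"
| "subformulae (S \<psi> \<xi>) = {S \<psi> \<xi>} \<union> subformulae \<psi> \<union> subformulae \<xi>"
| "subformulae (S' \<psi> \<xi>) = {S' \<psi> \<xi>} \<union> subformulae \<psi> \<union> subformulae \<xi>"
| "subformulae (B \<psi> \<xi>) = {B \<psi> \<xi>} \<union> subformulae \<psi> \<union> subformulae \<xi>"
| "subformulae (B' \<psi> \<xi>) = {B' \<psi> \<xi>} \<union> subformulae \<psi> \<union> subformulae \<xi>"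

definition psf :: "'a pltl \<Rightarrow> 'a pltl set" where
  "psf \<phi> = {\<psi> \<in> subformulae \<phi>. is_past \<psi>}"

fun weaken :: "'a pltl \<Rightarrow> 'a pltl" where
  "weaken (Y \<psi>) = Y' \<psi>"
| "weaken (S \<psi> \<xi>) = S' \<psi> \<xi>"
| "weaken (B \<psi> \<xi>) = B' \<psi> \<xi>"
| "weaken \<phi> = \<phi>"

fun strengthen :: "'a pltl \<Rightarrow> 'a pltl" where
  "strengthen (Y' \<psi>) = Y \<psi>"
| "strengthen (S' \<psi> \<xi>) = S \<psi> \<xi>"
| "strengthen (B' \<psi> \<xi>) = B \<psi> \<xi>"
| "strengthen \<phi> = \<phi>"


section \<open>Rewriting under a set of past formulae\<close>

definition adjust :: "bool \<Rightarrow> 'a pltl \<Rightarrow> 'a pltl" where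
  "adjust b \<phi> = (if b then weaken \<phi> else strengthen \<phi>)"

text \<open>Membership in \<open>C\<close> is tested on the formula as it was before its arguments were rewritten.\<close>

primrec rewrt :: "'a pltl \<Rightarrow> 'a pltl set \<Rightarrow> 'a pltl" ("_\<langle>_\<rangle>" [1000, 0] 1000) where
  "Tru\<langle>C\<rangle> = Tru"
| "Fls\<langle>C\<rangle> = Fls"
| "(Prop p)\<langle>C\<rangle> = Prop p"
| "(NProp p)\<langle>C\<rangle> = NProp p"
| "(And \<psi> \<xi>)\<langle>C\<rangle> = adjust (And \<psi> \<xi> \<in> C) (And (\<psi>\<langle>C\<rangle>) (\<xi>\<langle>C\<rangle>))"
| "(Or \<psi> \<xi>)\<langle>C\<rangle> = adjust (Or \<psi> \<xi> \<in> C) (Or (\<psi>\<langle>C\<rangle>) (\<xi>\<langle>C\<rangle>))"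
| "(X \<psi>)\<langle>C\<rangle> = adjust (X \<psi> \<in> C) (X (\<psi>\<langle>C\<rangle>))"
| "(U \<psi> \<xi>)\<langle>C\<rangle> = adjust (U \<psi> \<xi> \<in> C) (U (\<psi>\<langle>C\<rangle>) (\<xi>\<langle>C\<rangle>))"
| "(W \<psi> \<xi>)\<langle>C\<rangle> = adjust (W \<psi> \<xi> \<in> C) (W (\<psi>\<langle>C\<rangle>) (\<xi>\<langle>C\<rangle>))"
| "(R \<psi> \<xi>)\<langle>C\<rangle> = adjust (R \<psi> \<xi> \<in> C) (R (\<psi>\<langle>C\<rangle>) (\<xi>\<langle>C\<rangle>))"
| "(M \<psi> \<xi>)\<langle>C\<rangle> = adjust (M \<psi> \<xi> \<in> C) (M (\<psi>\<langle>C\<rangle>) (\<xi>\<langle>C\<rangle>))"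
| "(Y \<psi>)\<langle>C\<rangle> = adjust (Y \<psi> \<in> C) (Y (\<psi>\<langle>C\<rangle>))"
| "(Y' \<psi>)\<langle>C\<rangle> = adjust (Y' \<psi> \<in> C) (Y' (\<psi>\<langle>C\<rangle>))"
| "(S \<psi> \<xi>)\<langle>C\<rangle> = adjust (S \<psi> \<xi> \<in> C) (S (\<psi>\<langle>C\<rangle>) (\<xi>\<langle>C\<rangle>))"
| "(S' \<psi> \<xi>)\<langle>C\<rangle> = adjust (S' \<psi> \<xi> \<in> C) (S' (\<psi>\<langle>C\<rangle>) (\<xi>\<langle>C\<rangle>))"
| "(B \<psi> \<xi>)\<langle>C\<rangle> = adjust (B \<psi> \<xi> \<in> C) (B (\<psi>\<langle>C\<rangle>) (\<xi>\<langle>C\<rangle>))"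
| "(B' \<psi> \<xi>)\<langle>C\<rangle> = adjust (B' \<psi> \<xi> \<in> C) (B' (\<psi>\<langle>C\<rangle>) (\<xi>\<langle>C\<rangle>))"

definition rewrt_seq :: "'a pltl \<Rightarrow> 'a pltl set list \<Rightarrow> 'a pltl" where
  "rewrt_seq \<phi> Cs = foldl rewrt \<phi> Cs"


section \<open>Weakening conditions and entailed sets\<close>

text \<open>Weakening conditions are only meaningful, and only used, for past formulae.\<close>

fun wc :: "'a pltl \<Rightarrow> 'a pltl" where
  "wc (Y \<psi>) = \<psi>"
| "wc (Y' \<psi>) = \<psi>"
| "wc (S \<psi> \<xi>) = \<xi>"
| "wc (S' \<psi> \<xi>) = Or \<psi> \<xi>"
| "wc (B \<psi> \<xi>) = And \<psi> \<xi>"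
| "wc (B' \<psi> \<xi>) = \<xi>"
| "wc _ = undefined"

fun entailed :: "'a set word \<Rightarrow> 'a pltl \<Rightarrow> nat \<Rightarrow> 'a pltl set" where
  "entailed w \<phi> 0 = {\<psi> \<in> psf \<phi>. \<psi> = weaken \<psi>}"
| "entailed w \<phi> (Suc t) =
     {\<psi> \<in> psf (rewrt_seq \<phi> (map (entailed w \<phi>) [0..<Suc t])). suffix t w \<Turnstile> wc \<psi>}"

definition entailed_seq :: "'a set word \<Rightarrow> 'a pltl \<Rightarrow> nat \<Rightarrow> 'a pltl set list" where
  "entailed_seq w \<phi> t = map (entailed w \<phi>) [0..<Suc t]"

definition entailed_comp :: "'a set word \<Rightarrow> 'a pltl \<Rightarrow> nat \<Rightarrow> 'a pltl set" where
  "entailed_comp w \<phi> t =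
     {\<psi> \<in> psf \<phi>. rewrt_seq \<psi> (entailed_seq w \<phi> t) = weaken (rewrt_seq \<psi> (entailed_seq w \<phi> t))}"

end

theory Submission
  imports Defs
begin

text \<open>
  Reading the first letter of a word moves every obligation of a formula one step ahead, except
  that a past operator may have its witness in that letter. The weakening condition, evaluated on
  the word before the letter is read, says precisely when it does, and then the obligation that
  remains is the weak version of the operator; otherwise it is the strong version. Iterating this
  one-step fact along the word relates position \<open>t\<close> of \<open>w\<close> to the beginning of \<open>suffix t w\<close>.
  Since rewriting changes only the strength of past operators, the iterated rewriting equals a
  single rewriting under the set of those past subformulae that end up weak.
\<close>

lemma until_at_Suc: "until_at P Q (Suc n) \<longleftrightarrow> until_at (\<lambda>s. P (Suc s)) (\<lambda>s. Q (Suc s)) n"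
proof
  assume "until_at P Q (Suc n)"
  then obtain r where r: "Suc n \<le> r" "Q r" "\<forall>s. Suc n \<le> s \<and> s < r \<longrightarrow> P s"
    unfolding until_at_def by blast
  then obtain q where "r = Suc q" by (cases r) auto
  with r show "until_at (\<lambda>s. P (Suc s)) (\<lambda>s. Q (Suc s)) n"
    unfolding until_at_def by auto
next
  assume "until_at (\<lambda>s. P (Suc s)) (\<lambda>s. Q (Suc s)) n"
  then obtain r where r: "n \<le> r" "Q (Suc r)" "\<forall>s. n \<le> s \<and> s < r \<longrightarrow> P (Suc s)"
    unfolding until_at_def by blast
  have "P s" if "Suc n \<le> s" "s < Suc r" for s
    using that r(3) by (cases s) auto
  with r show "until_at P Q (Suc n)"
    unfolding until_at_def by (intro exI[of _ "Suc r"]) auto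
qed

lemma weak_until_at_Suc:
  "weak_until_at P Q (Suc n) \<longleftrightarrow> weak_until_at (\<lambda>s. P (Suc s)) (\<lambda>s. Q (Suc s)) n"
  unfolding weak_until_at_def until_at_Suc by (metis Suc_le_D Suc_le_mono)

text \<open>A witness at a successor position shifts along with the predicates. A witness at
  position \<open>0\<close> is lost by the shift, but leaves \<open>P\<close> on \<open>1\<close> to
  \<open>Suc n\<close>, which is the extra alternative of the weak since.\<close>

lemma since_at_Suc:
  "since_at P Q (Suc n) \<longleftrightarrow>
    (if Q 0 then weak_since_at (\<lambda>s. P (Suc s)) (\<lambda>s. Q (Suc s)) n
     else since_at (\<lambda>s. P (Suc s)) (\<lambda>s. Q (Suc s)) n)"
proof -
  have "since_at P Q (Suc n) \<longleftrightarrow>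
    since_at (\<lambda>s. P (Suc s)) (\<lambda>s. Q (Suc s)) n \<or> Q 0 \<and> (\<forall>s\<le>n. P (Suc s))"
  proof
    assume "since_at P Q (Suc n)"
    then obtain r where r: "r \<le> Suc n" "Q r" "\<forall>s. r < s \<and> s \<le> Suc n \<longrightarrow> P s"
      unfolding since_at_def by blast
    then show "since_at (\<lambda>s. P (Suc s)) (\<lambda>s. Q (Suc s)) n \<or> Q 0 \<and> (\<forall>s\<le>n. P (Suc s))"
      unfolding since_at_def by (cases r) auto
  next
    assume *: "since_at (\<lambda>s. P (Suc s)) (\<lambda>s. Q (Suc s)) n \<or> Q 0 \<and> (\<forall>s\<le>n. P (Suc s))"
    have P_shift: "P s" if "\<forall>s. r < Suc s \<and> s \<le> n \<longrightarrow> P (Suc s)" "r < s" "s \<le> Suc n" for r s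
      using that by (cases s) auto
    \<comment> \<open>The witness is the successor of the shifted one in the first disjunct and
      \<open>0\<close> in the second; the bound \<open>r < Suc s\<close> covers both.\<close>
    from * obtain r where "r \<le> Suc n" "Q r" "\<forall>s. r < Suc s \<and> s \<le> n \<longrightarrow> P (Suc s)"
      unfolding since_at_def by (metis Suc_less_eq Suc_le_mono le0)
    with P_shift show "since_at P Q (Suc n)"
      unfolding since_at_def by blast
  qed
  then show ?thesis
    by (auto simp: weak_since_at_def)
qed

text \<open>If only \<open>P 0\<close> holds, the alternative that \<open>P\<close> holds throughout
  survives the shift; if neither holds, that alternative fails and only a later witness
  remains.\<close>

lemma weak_since_at_Suc:
  "weak_since_at P Q (Suc n) \<longleftrightarrow>
    (if P 0 \<or> Q 0 then weak_since_at (\<lambda>s. P (Suc s)) (\<lambda>s. Q (Suc s)) n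
     else since_at (\<lambda>s. P (Suc s)) (\<lambda>s. Q (Suc s)) n)"
proof -
  have "(\<forall>s\<le>Suc n. P s) \<longleftrightarrow> P 0 \<and> (\<forall>s\<le>n. P (Suc s))"
    by (metis Suc_le_mono le0 not0_implies_Suc)
  then show ?thesis
    unfolding weak_since_at_def[of P] since_at_Suc by (auto simp: weak_since_at_def)
qed

lemmas at_Suc = until_at_Suc weak_until_at_Suc since_at_Suc weak_since_at_Suc

text \<open>As a rewrite rule, it also unfolds eta-expanded occurrences of the word \<open>suffix k w\<close> itself.\<close>

declare suffix_nth [simp del]

text \<open>An equality of functions lets the induction hypotheses rewrite the predicates under the
  temporal operators. The root of a past formula is then handled by \<open>at_Suc\<close>, whose
  case condition is the truth of \<open>wc\<close> on \<open>v\<close>.\<close>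

lemma sat_suffix_rewrt:
  assumes "\<And>\<psi>. \<psi> \<in> psf \<chi> \<Longrightarrow> \<psi> \<in> C \<longleftrightarrow> v \<Turnstile> wc \<psi>"
  shows "sat (suffix (Suc 0) v) (\<chi>\<langle>C\<rangle>) = (\<lambda>n. sat v \<chi> (Suc n))"
  using assms
proof (induction \<chi>)
  case (Prop p)
  show ?case by (simp add: suffix_nth)
next
  case (NProp p)
  show ?case by (simp add: suffix_nth)
next
  case (Y \<psi>)
  then have "sat (suffix (Suc 0) v) (\<psi>\<langle>C\<rangle>) = (\<lambda>m. sat v \<psi> (Suc m))"
    by (auto simp: psf_def)
  moreover have "Y \<psi> \<in> C \<longleftrightarrow> v \<Turnstile> \<psi>"
    using Y.prems[of "Y \<psi>"] by (simp add: psf_def)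
  \<comment> \<open>Only \<open>n = 0\<close> depends on the chosen strength: there \<open>Y\<close>
    is false and \<open>Y'\<close> is true, so membership in \<open>C\<close> supplies the value of
    \<open>\<psi>\<close> at position \<open>0\<close> of \<open>v\<close>.\<close>
  ultimately have "sat (suffix (Suc 0) v) ((Y \<psi>)\<langle>C\<rangle>) n \<longleftrightarrow> sat v (Y \<psi>) (Suc n)" for n
    by (cases n) (auto simp: adjust_def)
  then show ?case by (rule ext)
next
  case (Y' \<psi>)
  then have "sat (suffix (Suc 0) v) (\<psi>\<langle>C\<rangle>) = (\<lambda>m. sat v \<psi> (Suc m))"
    by (auto simp: psf_def)
  moreover have "Y' \<psi> \<in> C \<longleftrightarrow> v \<Turnstile> \<psi>"
    using Y'.prems[of "Y' \<psi>"] by (simp add: psf_def)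
  ultimately have "sat (suffix (Suc 0) v) ((Y' \<psi>)\<langle>C\<rangle>) n \<longleftrightarrow> sat v (Y' \<psi>) (Suc n)" for n
    by (cases n) (auto simp: adjust_def)
  then show ?case by (rule ext)
next
  case (S \<psi> \<xi>)
  then have "sat (suffix (Suc 0) v) (\<psi>\<langle>C\<rangle>) = (\<lambda>m. sat v \<psi> (Suc m))"
    and "sat (suffix (Suc 0) v) (\<xi>\<langle>C\<rangle>) = (\<lambda>m. sat v \<xi> (Suc m))"
    by (auto simp: psf_def)
  moreover have "S \<psi> \<xi> \<in> C \<longleftrightarrow> v \<Turnstile> \<xi>"
    using S.prems[of "S \<psi> \<xi>"] by (simp add: psf_def)
  ultimately show ?case by (auto intro!: ext simp: adjust_def at_Suc)
next
  case (S' \<psi> \<xi>)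
  then have "sat (suffix (Suc 0) v) (\<psi>\<langle>C\<rangle>) = (\<lambda>m. sat v \<psi> (Suc m))"
    and "sat (suffix (Suc 0) v) (\<xi>\<langle>C\<rangle>) = (\<lambda>m. sat v \<xi> (Suc m))"
    by (auto simp: psf_def)
  moreover have "S' \<psi> \<xi> \<in> C \<longleftrightarrow> v \<Turnstile> \<psi> \<or> v \<Turnstile> \<xi>"
    using S'.prems[of "S' \<psi> \<xi>"] by (simp add: psf_def)
  ultimately show ?case by (auto intro!: ext simp: adjust_def at_Suc)
next
  case (B \<psi> \<xi>)
  then have "sat (suffix (Suc 0) v) (\<psi>\<langle>C\<rangle>) = (\<lambda>m. sat v \<psi> (Suc m))"
    and "sat (suffix (Suc 0) v) (\<xi>\<langle>C\<rangle>) = (\<lambda>m. sat v \<xi> (Suc m))"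
    by (auto simp: psf_def)
  moreover have "B \<psi> \<xi> \<in> C \<longleftrightarrow> v \<Turnstile> \<psi> \<and> v \<Turnstile> \<xi>"
    using B.prems[of "B \<psi> \<xi>"] by (simp add: psf_def)
  ultimately show ?case by (auto intro!: ext simp: adjust_def at_Suc)
next
  case (B' \<psi> \<xi>)
  then have "sat (suffix (Suc 0) v) (\<psi>\<langle>C\<rangle>) = (\<lambda>m. sat v \<psi> (Suc m))"
    and "sat (suffix (Suc 0) v) (\<xi>\<langle>C\<rangle>) = (\<lambda>m. sat v \<xi> (Suc m))"
    by (auto simp: psf_def)
  \<comment> \<open>Here \<open>P\<close> is \<open>\<xi>\<close> and \<open>Q\<close> is
    \<open>\<psi>\<close> and \<open>\<xi>\<close>, so \<open>P 0 \<or> Q 0\<close> collapses to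
    \<open>\<xi>\<close>.\<close>
  moreover have "B' \<psi> \<xi> \<in> C \<longleftrightarrow> v \<Turnstile> \<xi>"
    using B'.prems[of "B' \<psi> \<xi>"] by (simp add: psf_def)
  ultimately show ?case by (auto intro!: ext simp: adjust_def at_Suc)
qed (auto intro!: ext simp: psf_def adjust_def at_Suc)

text \<open>Such a set prescribes for each past operator the strength it already has. This is the
  initial entailed set, so the first rewriting has no effect.\<close>

lemma rewrt_weak_past:
  assumes "\<And>\<psi>. \<psi> \<in> psf \<chi> \<Longrightarrow> \<psi> \<in> C \<longleftrightarrow> \<psi> = weaken \<psi>"
  shows "\<chi>\<langle>C\<rangle> = \<chi>"
  using assms by (induction \<chi>) (simp_all add: psf_def adjust_def)

lemma rewrt_seq_Nil: "rewrt_seq \<psi> [] = \<psi>"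
  and rewrt_seq_snoc: "rewrt_seq \<psi> (Cs @ [C]) = (rewrt_seq \<psi> Cs)\<langle>C\<rangle>"
  by (simp_all add: rewrt_seq_def)

lemma entailed_seq_0: "entailed_seq w \<phi> 0 = [entailed w \<phi> 0]"
  and entailed_seq_Suc: "entailed_seq w \<phi> (Suc t) = entailed_seq w \<phi> t @ [entailed w \<phi> (Suc t)]"
  by (simp_all add: entailed_seq_def del: entailed.simps)

lemma entailed_Suc:
  "entailed w \<phi> (Suc t) = {\<psi> \<in> psf (rewrt_seq \<phi> (entailed_seq w \<phi> t)). suffix t w \<Turnstile> wc \<psi>}"
  by (simp add: entailed_seq_def)

text \<open>The offset \<open>n\<close> is general because the step from \<open>t\<close> to
  \<open>Suc t\<close> uses the induction hypothesis at \<open>Suc n\<close>.\<close>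

lemma sat_suffix_rewrt_seq:
  "sat (suffix t w) (rewrt_seq \<phi> (entailed_seq w \<phi> t)) n \<longleftrightarrow> sat w \<phi> (t + n)"
proof (induction t arbitrary: n)
  case 0
  have "\<phi>\<langle>entailed w \<phi> 0\<rangle> = \<phi>"
    by (rule rewrt_weak_past) simp
  then show ?case
    by (simp add: entailed_seq_0 rewrt_seq_def del: entailed.simps)
next
  case (Suc t)
  \<comment> \<open>The one-letter fact applies with \<open>suffix t w\<close> as the word:
    \<open>entailed_Suc\<close> selects past subformulae of the current formula by the truth of
    \<open>wc\<close> on that suffix.\<close>
  have "sat (suffix (Suc 0) (suffix t w))
      ((rewrt_seq \<phi> (entailed_seq w \<phi> t))\<langle>entailed w \<phi> (Suc t)\<rangle>) n
    \<longleftrightarrow> sat (suffix t w) (rewrt_seq \<phi> (entailed_seq w \<phi> t)) (Suc n)"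
    by (subst sat_suffix_rewrt) (simp_all add: entailed_Suc del: entailed.simps)
  with Suc.IH[of "Suc n"] show ?case
    by (simp add: entailed_seq_Suc rewrt_seq_snoc del: entailed.simps)
qed

lemma rewrt_seq_atom:
  "rewrt_seq Tru Cs = Tru"
  "rewrt_seq Fls Cs = Fls"
  "rewrt_seq (Prop p) Cs = Prop p"
  "rewrt_seq (NProp p) Cs = NProp p"
  by (induction Cs rule: rev_induct) (simp_all add: rewrt_seq_Nil rewrt_seq_snoc)

lemma rewrt_seq_nonpast:
  "rewrt_seq (And \<psi> \<xi>) Cs = And (rewrt_seq \<psi> Cs) (rewrt_seq \<xi> Cs)"
  "rewrt_seq (Or \<psi> \<xi>) Cs = Or (rewrt_seq \<psi> Cs) (rewrt_seq \<xi> Cs)"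
  "rewrt_seq (X \<psi>) Cs = X (rewrt_seq \<psi> Cs)"
  "rewrt_seq (U \<psi> \<xi>) Cs = U (rewrt_seq \<psi> Cs) (rewrt_seq \<xi> Cs)"
  "rewrt_seq (W \<psi> \<xi>) Cs = W (rewrt_seq \<psi> Cs) (rewrt_seq \<xi> Cs)"
  "rewrt_seq (R \<psi> \<xi>) Cs = R (rewrt_seq \<psi> Cs) (rewrt_seq \<xi> Cs)"
  "rewrt_seq (M \<psi> \<xi>) Cs = M (rewrt_seq \<psi> Cs) (rewrt_seq \<xi> Cs)"
  by (induction Cs rule: rev_induct) (simp_all add: rewrt_seq_Nil rewrt_seq_snoc adjust_def)

text \<open>Each step may flip the strength of the root, while the arguments evolve independently of
  it. The final strength is left open here.\<close>

lemma rewrt_seq_past: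
  "rewrt_seq (Y \<psi>) Cs \<in> {Y (rewrt_seq \<psi> Cs), Y' (rewrt_seq \<psi> Cs)}"
  "rewrt_seq (Y' \<psi>) Cs \<in> {Y (rewrt_seq \<psi> Cs), Y' (rewrt_seq \<psi> Cs)}"
  "rewrt_seq (S \<psi> \<xi>) Cs
    \<in> {S (rewrt_seq \<psi> Cs) (rewrt_seq \<xi> Cs), S' (rewrt_seq \<psi> Cs) (rewrt_seq \<xi> Cs)}"
  "rewrt_seq (S' \<psi> \<xi>) Cs
    \<in> {S (rewrt_seq \<psi> Cs) (rewrt_seq \<xi> Cs), S' (rewrt_seq \<psi> Cs) (rewrt_seq \<xi> Cs)}"
  "rewrt_seq (B \<psi> \<xi>) Cs
    \<in> {B (rewrt_seq \<psi> Cs) (rewrt_seq \<xi> Cs), B' (rewrt_seq \<psi> Cs) (rewrt_seq \<xi> Cs)}"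
  "rewrt_seq (B' \<psi> \<xi>) Cs
    \<in> {B (rewrt_seq \<psi> Cs) (rewrt_seq \<xi> Cs), B' (rewrt_seq \<psi> Cs) (rewrt_seq \<xi> Cs)}"
  by (induction Cs rule: rev_induct)
    (auto simp: rewrt_seq_Nil rewrt_seq_snoc adjust_def)

text \<open>Of the two possible final roots, only the weak one is fixed by \<open>weaken\<close>, so
  membership in \<open>D\<close> determines which one occurs.\<close>

lemma rewrt_eq_rewrt_seq:
  assumes "\<And>\<psi>. \<psi> \<in> psf \<chi> \<Longrightarrow> \<psi> \<in> D \<longleftrightarrow> rewrt_seq \<psi> Cs = weaken (rewrt_seq \<psi> Cs)"
  shows "\<chi>\<langle>D\<rangle> = rewrt_seq \<chi> Cs"
  using assms
proof (induction \<chi>)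
  case (Y \<psi>)
  then show ?case
    using rewrt_seq_past(1)[of \<psi> Cs] by (auto simp: psf_def adjust_def)
next
  case (Y' \<psi>)
  then show ?case
    using rewrt_seq_past(2)[of \<psi> Cs] by (auto simp: psf_def adjust_def)
next
  case (S \<psi> \<xi>)
  then show ?case
    using rewrt_seq_past(3)[of \<psi> \<xi> Cs] by (auto simp: psf_def adjust_def)
next
  case (S' \<psi> \<xi>)
  then show ?case
    using rewrt_seq_past(4)[of \<psi> \<xi> Cs] by (auto simp: psf_def adjust_def)
next
  case (B \<psi> \<xi>)
  then show ?case
    using rewrt_seq_past(5)[of \<psi> \<xi> Cs] by (auto simp: psf_def adjust_def)
next
  case (B' \<psi> \<xi>)
  then show ?case
    using rewrt_seq_past(6)[of \<psi> \<xi> Cs] by (auto simp: psf_def adjust_def)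
qed (simp_all add: psf_def adjust_def rewrt_seq_atom rewrt_seq_nonpast)

theorem lemma9:
  fixes \<phi> :: "'a pltl" and w :: "'a set word" and t :: nat
  assumes "range w \<subseteq> Pow (vars \<phi>)"
  shows "sat w \<phi> t \<longleftrightarrow> suffix t w \<Turnstile> \<phi>\<langle>entailed_comp w \<phi> t\<rangle>"
proof -
  have "\<phi>\<langle>entailed_comp w \<phi> t\<rangle> = rewrt_seq \<phi> (entailed_seq w \<phi> t)"
    by (rule rewrt_eq_rewrt_seq) (simp add: entailed_comp_def)
  with sat_suffix_rewrt_seq[of t w \<phi> 0] show ?thesis by simp
qed

end
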